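(* Let $d,K,r,p\ge1$ be integers with $r\le d$, let $D=\binom{d+p-1}{p}$, let $\mathcal V\subset\mathbb R^d$ be a generic union of $K$ $r$-dimensional subspaces, and let $\mathcal S\subset\mathbb R^D$ be its $p$-th order tensorized subspace. Assume $m^*$ is an integer such that $r<m^*\le d$ and $R(m^*,K,r,p)=R(d,K,r,p)$. Then for every integer $m$ with $m^*+p\le m\le d$, the subspace $\mathcal S$ is uniquely identifiable from its canonical projections onto all possible tensorized observation patterns of size $m$.
   Context: Tensorization: for $x\in\mathbb R^d$, $x^{\otimes p}\in\mathbb R^D$ with $D=\binom{d+p-1}{p}$ denotes the vector whose coordinates are indexed by tuples $1\le k_1\le\cdots\le k_p\le d$, the coordinate $(k_1,\dots,k_p)$ being $x_{k_1}\cdots x_{k_p}$. The $p$-th order tensorized subspace of a set $\mathcal V\subset\mathbb R^d$ is $\mathcal S=\operatorname{span}\{x^{\otimes p}:x\in\mathcal V\}\subset\mathbb R^D$. Genericity: a statement holds for a generic union of $K$ $r$-dimensional subspaces of $\mathbb R^d$ if it holds for $\mathcal V=\mathcal U_1\cup\cdots\cup\mathcal U_K$ for all tuples $(\mathcal U_1,\dots,\mathcal U_K)$ in some open dense subset of $\mathbb G(r,\mathbb R^d)\times\cdots\times\mathbb G(r,\mathbb R^d)$ ($K$ factors), where $\mathbb G(r,\mathbb R^d)$ is the Grassmannian of $r$-dimensional subspaces of $\mathbb R^d$. The number $R(d,K,r,p)$ denotes the dimension of the $p$-th order tensorized subspace of a generic union of $K$ $r$-dimensional subspaces of $\mathbb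 R^d$; it is a known fact that for generic unions this dimension is a constant depending only on $d,K,r,p$. Observation patterns: for a binary vector $\omega$, $|\omega|$ is its number of ones. For $\omega\in\{0,1\}^d$, $\omega^{\otimes p}\in\{0,1\}^D$ is called a tensorized observation pattern; it has size $m$ if $|\omega|=m$. For $\upsilon\in\{0,1\}^D$, $\mathcal S_\upsilon=\{y_\upsilon:y\in\mathcal S\}\subset\mathbb R^{|\upsilon|}$, where $y_\upsilon$ is the restriction of $y$ to the coordinates where $\upsilon$ equals one, is the canonical projection of $\mathcal S$ onto $\upsilon$. A subspace $\mathcal S\subset\mathbb R^D$ is uniquely identifiable from its canonical projections onto patterns $\upsilon_1,\dots,\upsilon_n$ if the only subspace $\mathcal S'\subset\mathbb R^D$ with $\mathcal S'_{\upsilon_i}=\mathcal S_{\upsilon_i}$ for all $i$ is $\mathcal S'=\mathcal S$. *)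

theory Defs
  imports "HOL-Analysis.Analysis" "HOL-Library.Function_Algebras"
begin

text \<open>Pointwise real vector space structure on functions; the libraries provide only the
  additive group structure (and the product topology).\<close>

instantiation "fun" :: (type, real_vector) real_vector
begin

definition scaleR_fun :: "real \<Rightarrow> ('a \<Rightarrow> 'b) \<Rightarrow> 'a \<Rightarrow> 'b"
  where "scaleR_fun c f = (\<lambda>x. c *\<^sub>R f x)"

instance
  by standard (auto simp: scaleR_fun_def fun_eq_iff algebra_simps)

end

text \<open>\<open>coord_space I\<close> plays the role of the coordinate space with index set \<open>I\<close>: functions on the
  whole index type that vanish off \<open>I\<close>. Dimensions are thus ordinary natural numbers, so that
  different ambient spaces can occur in one statement.\<close>

definition coord_space :: "'a set \<Rightarrow> ('a \<Rightarrow> real) set"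
  where "coord_space I = {x. \<forall>i. i \<notin> I \<longrightarrow> x i = 0}"

abbreviation Rn :: "nat \<Rightarrow> (nat \<Rightarrow> real) set"
  where "Rn d \<equiv> coord_space {1..d}"


section \<open>Tensorization\<close>

definition sorted_tuples :: "nat \<Rightarrow> nat \<Rightarrow> nat list set"
  where "sorted_tuples d p = {ks. length ks = p \<and> sorted ks \<and> set ks \<subseteq> {1..d}}"

lemma card_sorted_tuples: "card (sorted_tuples d p) = (d + p - 1) choose p"
proof -
  have "bij_betw mset (sorted_tuples d p) (multisets_of_size {1..d} p)"
  proof (rule bij_betwI[where g = sorted_list_of_multiset])
    show "sorted_list_of_multiset \<in> multisets_of_size {1..d} p \<rightarrow> sorted_tuples d p"
    proof
      fix M assume "M \<in> multisets_of_size {1..d} p"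
      moreover have "length (sorted_list_of_multiset M) = size M"
        by (metis mset_sorted_list_of_multiset size_mset)
      ultimately show "sorted_list_of_multiset M \<in> sorted_tuples d p"
        by (simp add: sorted_tuples_def multisets_of_size_def)
    qed
  qed (auto simp: sorted_tuples_def multisets_of_size_def sorted_sort_id)
  then have "card (sorted_tuples d p) = card (multisets_of_size {1..d} p)"
    by (rule bij_betw_same_card)
  then show ?thesis
    by (simp add: card_multisets_of_size)
qed

definition tensor_power :: "nat \<Rightarrow> nat \<Rightarrow> (nat \<Rightarrow> real) \<Rightarrow> (nat list \<Rightarrow> real)"
  where "tensor_power d p x =
    (\<lambda>ks. if ks \<in> sorted_tuples d p then prod_list (map x ks) else 0)"

abbreviation RD :: "nat \<Rightarrow> nat \<Rightarrow> (nat list \<Rightarrow> real) set"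
  where "RD d p \<equiv> coord_space (sorted_tuples d p)"

definition tensorized_subspace :: "nat \<Rightarrow> nat \<Rightarrow> (nat \<Rightarrow> real) set \<Rightarrow> (nat list \<Rightarrow> real) set"
  where "tensorized_subspace d p V = span (tensor_power d p ` V)"


section \<open>Grassmannians and genericity\<close>

definition Grassmannian :: "nat \<Rightarrow> nat \<Rightarrow> (nat \<Rightarrow> real) set set"
  where "Grassmannian r d = {U. subspace U \<and> U \<subseteq> Rn d \<and> dim U = r}"

text \<open>Linearly independent \<open>r\<close>-tuples of vectors (the noncompact Stiefel manifold); \<open>B i\<close> is the
  \<open>i\<close>-th vector.\<close>

definition frames :: "nat \<Rightarrow> nat \<Rightarrow> (nat \<Rightarrow> nat \<Rightarrow> real) set"
  where "frames r d = {B. (\<forall>i\<in>{1..r}. B i \<in> Rn d) \<and> (\<forall>i. i \<notin> {1..r} \<longrightarrow> B i = 0) \<and>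
    inj_on B {1..r} \<and> independent (B ` {1..r})}"

definition frame_span :: "nat \<Rightarrow> (nat \<Rightarrow> nat \<Rightarrow> real) \<Rightarrow> (nat \<Rightarrow> real) set"
  where "frame_span r B = span (B ` {1..r})"

text \<open>The usual topology of the Grassmannian: the quotient topology under \<open>frame_span\<close>
  (see \<open>quotient_map_frame_span\<close>).\<close>

definition Grassmannian_topology :: "nat \<Rightarrow> nat \<Rightarrow> (nat \<Rightarrow> real) set topology"
  where "Grassmannian_topology r d = topology (\<lambda>\<U>. \<U> \<subseteq> Grassmannian r d \<and>
    openin (top_of_set (frames r d)) {B \<in> frames r d. frame_span r B \<in> \<U>})"

lemma openin_Grassmannian_topology:
  "openin (Grassmannian_topology r d) \<U> \<longleftrightarrow> \<U> \<subseteq> Grassmannian r d \<and>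
    openin (top_of_set (frames r d)) {B \<in> frames r d. frame_span r B \<in> \<U>}"
proof -
  let ?P = "\<lambda>\<U>. \<U> \<subseteq> Grassmannian r d \<and>
    openin (top_of_set (frames r d)) {B \<in> frames r d. frame_span r B \<in> \<U>}"
  have "istopology ?P"
    unfolding istopology_def
  proof (intro conjI allI impI)
    fix S T assume "?P S" "?P T"
    moreover have "{B \<in> frames r d. frame_span r B \<in> S \<inter> T} =
        {B \<in> frames r d. frame_span r B \<in> S} \<inter> {B \<in> frames r d. frame_span r B \<in> T}"
      by blast
    ultimately show "S \<inter> T \<subseteq> Grassmannian r d"
      and "openin (top_of_set (frames r d)) {B \<in> frames r d. frame_span r B \<in> S \<inter> T}"
      by (auto intro: openin_Int)
  next
    fix \<K> assume *: "\<forall>K\<in>\<K>. ?P K"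
    have "{B \<in> frames r d. frame_span r B \<in> \<Union>\<K>} =
        \<Union>((\<lambda>K. {B \<in> frames r d. frame_span r B \<in> K}) ` \<K>)"
      by blast
    with * show "openin (top_of_set (frames r d)) {B \<in> frames r d. frame_span r B \<in> \<Union>\<K>}"
      by (auto intro!: openin_Union)
    from * show "\<Union>\<K> \<subseteq> Grassmannian r d" by blast
  qed
  then show ?thesis
    by (simp add: Grassmannian_topology_def topology_inverse')
qed

lemma subspace_coord_space: "subspace (coord_space I)"
  by (auto simp: subspace_def coord_space_def scaleR_fun_def)

lemma frame_span_in_Grassmannian:
  assumes "B \<in> frames r d" shows "frame_span r B \<in> Grassmannian r d"
proof -
  have "span (B ` {1..r}) \<subseteq> Rn d"
    using assms by (intro span_minimal subspace_coord_space) (auto simp: frames_def)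
  moreover have "dim (span (B ` {1..r})) = r"
    using assms by (simp add: frames_def dim_eq_card_independent card_image)
  ultimately show ?thesis
    by (simp add: Grassmannian_def frame_span_def)
qed

lemma topspace_Grassmannian_topology [simp]:
  "topspace (Grassmannian_topology r d) = Grassmannian r d"
proof -
  have "{B \<in> frames r d. frame_span r B \<in> Grassmannian r d} = frames r d"
    using frame_span_in_Grassmannian by blast
  then have "openin (Grassmannian_topology r d) (Grassmannian r d)"
    by (simp add: openin_Grassmannian_topology)
  then show ?thesis
    by (metis openin_Grassmannian_topology openin_subset openin_topspace subset_antisym)
qed

lemma quotient_map_frame_span:
  assumes "r \<ge> 1"
  shows "quotient_map (top_of_set (frames r d)) (Grassmannian_topology r d) (frame_span r)"
proof -
  have "U \<in> frame_span r ` frames r d" if U: "U \<in> Grassmannian r d" for U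
  proof -
    obtain C where C: "C \<subseteq> U" "independent C" "U \<subseteq> span C" "card C = dim U"
      using basis_exists by blast
    then have "finite C" "card C = r"
      using U assms by (auto simp: Grassmannian_def intro!: card_ge_0_finite)
    then obtain h where h: "bij_betw h {1..r} C"
      using ex_bij_betw_nat_finite_1 by blast
    define B where "B = (\<lambda>i. if i \<in> {1..r} then h i else 0)"
    have "bij_betw B {1..r} C"
      using h by (rule bij_betw_cong[THEN iffD1, rotated]) (simp add: B_def)
    then have img: "B ` {1..r} = C" and inj: "inj_on B {1..r}"
      by (simp_all add: bij_betw_def)
    have "B i \<in> Rn d" if "i \<in> {1..r}" for i
    proof -
      have "B i \<in> C" using img that by blast
      with C U show ?thesis by (auto simp: Grassmannian_def)
    qed
    moreover have "B i = 0" if "i \<notin> {1..r}" for i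
      unfolding B_def using that by (rule if_not_P)
    ultimately have B: "B \<in> frames r d"
      unfolding frames_def using img inj C by blast
    have "span C \<subseteq> U"
      using C U by (intro span_minimal) (auto simp: Grassmannian_def)
    then have "frame_span r B = U"
      unfolding frame_span_def img using C by blast
    with B show ?thesis by blast
  qed
  then have "frame_span r ` frames r d = Grassmannian r d"
    using frame_span_in_Grassmannian by blast
  then show ?thesis
    by (simp add: quotient_map_def openin_Grassmannian_topology)
qed

abbreviation Grassmannian_power :: "nat \<Rightarrow> nat \<Rightarrow> nat \<Rightarrow> (nat \<Rightarrow> (nat \<Rightarrow> real) set) topology"
  where "Grassmannian_power d K r \<equiv> product_topology (\<lambda>_. Grassmannian_topology r d) {1..K}"

definition generic_union ::
    "nat \<Rightarrow> nat \<Rightarrow> nat \<Rightarrow> ((nat \<Rightarrow> real) set \<Rightarrow> bool) \<Rightarrow> bool"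
  where "generic_union d K r P \<longleftrightarrow>
    (\<exists>\<O>. openin (Grassmannian_power d K r) \<O> \<and>
         (Grassmannian_power d K r) closure_of \<O> = topspace (Grassmannian_power d K r) \<and>
         (\<forall>U\<in>\<O>. P (\<Union>k\<in>{1..K}. U k)))"

text \<open>For \<open>r \<le> d\<close> the dimension is constant on generic unions, and unique because any two open
  dense sets meet; this constant is what the definite description denotes.\<close>

definition generic_dim :: "nat \<Rightarrow> nat \<Rightarrow> nat \<Rightarrow> nat \<Rightarrow> nat"
  where "generic_dim d K r p =
    (THE n. generic_union d K r (\<lambda>V. dim (tensorized_subspace d p V) = n))"


section \<open>Observation patterns and identifiability\<close>

definition tensorized_patterns :: "nat \<Rightarrow> nat \<Rightarrow> nat \<Rightarrow> (nat list \<Rightarrow> real) set"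
  where "tensorized_patterns d p m =
    tensor_power d p ` {\<omega> \<in> Rn d. (\<forall>i. \<omega> i \<in> {0, 1}) \<and> card {i. \<omega> i = 1} = m}"

text \<open>Pattern vectors vanish off the index set, so \<open>{k. \<upsilon> k = 1}\<close> contains only genuine coordinates.\<close>

definition canonical_projection :: "('a \<Rightarrow> real) \<Rightarrow> ('a \<Rightarrow> real) set \<Rightarrow> ('a \<Rightarrow> real) set"
  where "canonical_projection \<upsilon> S = (\<lambda>y. restrict y {k. \<upsilon> k = 1}) ` S"

definition uniquely_identifiable ::
    "('a \<Rightarrow> real) set \<Rightarrow> ('a \<Rightarrow> real) set \<Rightarrow> ('a \<Rightarrow> real) set \<Rightarrow> bool"
  where "uniquely_identifiable E \<Upsilon> S \<longleftrightarrow>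
    (\<forall>S'. subspace S' \<and> S' \<subseteq> E \<and>
       (\<forall>\<upsilon>\<in>\<Upsilon>. canonical_projection \<upsilon> S' = canonical_projection \<upsilon> S) \<longrightarrow> S' = S)"

end

theory Submission
  imports Defs "Jordan_Normal_Form.Determinant"
begin

text \<open>Write \<open>N(s, d)\<close> for the largest dimension of \<open>tensorized_subspace s p (\<Union>k. U k)\<close>, where the
  \<open>U k\<close> are \<open>r\<close>-dimensional subspaces of \<open>Rn d\<close>. Linear independence of tensors of vectors with fixed
  coefficients in the frames of the \<open>U k\<close> is implied by the nonvanishing of a minor that is polynomial
  in the frames, so \<open>N(s, d)\<close> is attained on an open dense set; in particular \<open>N(d, d)\<close>
  is the generic dimension. From \<open>N(s, s) \<le> N(s, d) \<le> N(d, d)\<close> and equality of the two outer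
  terms, the restriction of a generic tensorized subspace to the tuples in \<open>{1..s}\<close> is injective.
  Given a tuple \<open>ks\<close>, some \<open>J\<close> of size \<open>m \<ge> s + p\<close> contains both \<open>{1..s}\<close> and the entries of \<open>ks\<close>.
  The projection onto \<open>J\<close> relates a competing subspace to the given one in the coordinate \<open>ks\<close> and in
  the tuples in \<open>{1..s}\<close>, and the latter already determine the element.\<close>

section \<open>Linear independence and spans of finite indexed families\<close>

lemma sum_fun_apply: "(\<Sum>i\<in>A. f i) x = (\<Sum>i\<in>A. f i x)"
  by (induction A rule: infinite_finite_induct) auto

text \<open>Independence of a set does not see repeated vectors, hence the injectivity on the left.
  The coefficient form on the right can be compared with the kernel of a matrix.\<close>

lemma inj_on_independent_image_iff:
  fixes w :: "'i \<Rightarrow> 'v::real_vector"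
  assumes "finite A"
  shows "inj_on w A \<and> independent (w ` A) \<longleftrightarrow>
    (\<forall>c. (\<Sum>i\<in>A. c i *\<^sub>R w i) = 0 \<longrightarrow> (\<forall>i\<in>A. c i = 0))"
proof (intro iffI conjI allI impI ballI)
  fix c i assume *: "inj_on w A \<and> independent (w ` A)" and 0: "(\<Sum>i\<in>A. c i *\<^sub>R w i) = 0" and i: "i \<in> A"
  define u where "u = c \<circ> inv_into A w"
  have "(\<Sum>x\<in>w ` A. u x *\<^sub>R x) = (\<Sum>i\<in>A. c i *\<^sub>R w i)"
    using * by (subst sum.reindex) (auto simp: u_def intro!: sum.cong)
  then have "(\<Sum>x\<in>w ` A. u x *\<^sub>R x) = 0" using 0 by simp
  then have "u (w i) = 0"
    using * i assms unfolding real_vector.independent_explicit_finite_subsets by blast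
  then show "c i = 0" using * i by (simp add: u_def)
next
  assume *: "\<forall>c. (\<Sum>i\<in>A. c i *\<^sub>R w i) = 0 \<longrightarrow> (\<forall>i\<in>A. c i = 0)"
  show inj: "inj_on w A"
  proof (rule inj_onI, rule ccontr)
    fix i j assume ij: "i \<in> A" "j \<in> A" "w i = w j" "i \<noteq> j"
    \<comment> \<open>A repeated vector would give a nontrivial relation with coefficients 1 and
      -1.\<close>
    let ?c = "\<lambda>k. if k = i then 1 else if k = j then - 1 else (0::real)"
    have "(\<Sum>k\<in>A. ?c k *\<^sub>R w k) = (\<Sum>k\<in>{i, j}. ?c k *\<^sub>R w k)"
      using ij assms by (intro sum.mono_neutral_right) auto
    also have "\<dots> = 0" using ij by simp
    finally show False using * ij by force
  qed
  show "independent (w ` A)"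
  proof (rule real_vector.independent_if_scalars_zero)
    fix f x assume 0: "(\<Sum>x\<in>w ` A. f x *\<^sub>R x) = 0" and x: "x \<in> w ` A"
    have "(\<Sum>i\<in>A. f (w i) *\<^sub>R w i) = 0"
      using 0 inj by (subst (asm) sum.reindex) auto
    then show "f x = 0" using * x by auto
  qed (use assms in simp)
qed

text \<open>Coefficients indexed by \<open>A\<close> can be held fixed while the family
  \<open>w\<close> varies; this is how vectors of a subspace will be moved along with a
  frame.\<close>

lemma in_span_image_finite_iff:
  fixes w :: "'i \<Rightarrow> 'v::real_vector"
  assumes "finite A"
  shows "x \<in> span (w ` A) \<longleftrightarrow> (\<exists>c. x = (\<Sum>i\<in>A. c i *\<^sub>R w i))"
proof
  have sub: "subspace {x. \<exists>c. x = (\<Sum>i\<in>A. c i *\<^sub>R w i)}" (is "subspace ?S")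
  proof (rule subspaceI)
    show "0 \<in> ?S" by (auto intro!: exI[of _ "\<lambda>_. 0"])
  next
    fix x y assume "x \<in> ?S" "y \<in> ?S"
    then obtain c c' where "x = (\<Sum>i\<in>A. c i *\<^sub>R w i)" "y = (\<Sum>i\<in>A. c' i *\<^sub>R w i)" by auto
    then have "x + y = (\<Sum>i\<in>A. (c i + c' i) *\<^sub>R w i)"
      by (simp add: scaleR_add_left sum.distrib)
    then show "x + y \<in> ?S" by auto
  next
    fix a x assume "x \<in> ?S"
    then obtain c where "x = (\<Sum>i\<in>A. c i *\<^sub>R w i)" by auto
    then have "a *\<^sub>R x = (\<Sum>i\<in>A. (a * c i) *\<^sub>R w i)"
      by (simp add: scaleR_sum_right)
    then show "a *\<^sub>R x \<in> ?S" by auto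
  qed
  have "w i \<in> ?S" if "i \<in> A" for i
    using that assms by (auto intro!: exI[of _ "\<lambda>k. if k = i then 1 else 0"] simp: if_distrib[of "\<lambda>c. c *\<^sub>R _"] cong: if_cong)
  then have "span (w ` A) \<subseteq> ?S" by (intro span_minimal sub) auto
  then show "\<exists>c. x = (\<Sum>i\<in>A. c i *\<^sub>R w i)" if "x \<in> span (w ` A)" using that by auto
qed (auto intro: span_sum span_scale span_base)

section \<open>Functions that are polynomial along lines\<close>

text \<open>A substitute for polynomials in the entries of frames, which live in an
  infinite-dimensional function space. Continuity makes nonvanishing an open condition;
  polynomiality on lines makes it dense once it holds somewhere.\<close>

definition regular :: "('b::{real_vector,topological_space} \<Rightarrow> real) \<Rightarrow> bool"
  where "regular F \<longleftrightarrow> continuous_on UNIV F \<and>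
    (\<forall>x y. real_polynomial_function (\<lambda>t::real. F (x + t *\<^sub>R (y - x))))"

lemma regular_const: "regular (\<lambda>_. c)"
  by (auto simp: regular_def)

text \<open>On a line a linear functional is affine in \<open>t\<close>. Continuity is a separate
  hypothesis because in infinite dimension it does not follow from linearity.\<close>

lemma regular_linear:
  assumes "linear f" and "continuous_on UNIV f" shows "regular f"
proof -
  have "f (x + t *\<^sub>R (y - x)) = f x + t * f (y - x)" for x y t
    using assms(1) by (simp add: linear_add linear_scale)
  then show ?thesis
    using assms(2)
    by (auto simp: regular_def intro!: real_polynomial_function.intros(2-4)
        real_polynomial_function.intros(1)[OF bounded_linear_ident])
qed

lemma regular_add: "regular f \<Longrightarrow> regular g \<Longrightarrow> regular (\<lambda>x. f x + g x)"
  by (auto simp: regular_def intro!: continuous_intros)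

lemma regular_mult: "regular f \<Longrightarrow> regular g \<Longrightarrow> regular (\<lambda>x. f x * g x)"
  by (auto simp: regular_def intro!: continuous_intros)

lemma regular_sum: "(\<And>i. i \<in> A \<Longrightarrow> regular (f i)) \<Longrightarrow> regular (\<lambda>x. \<Sum>i\<in>A. f i x)"
  by (induction A rule: infinite_finite_induct) (auto intro: regular_const regular_add)

lemma regular_prod: "(\<And>i. i \<in> A \<Longrightarrow> regular (f i)) \<Longrightarrow> regular (\<lambda>x. \<Prod>i\<in>A. f i x)"
  by (induction A rule: infinite_finite_induct) (auto intro: regular_const regular_mult)

lemma regular_prod_list: "(\<And>k. k \<in> set ks \<Longrightarrow> regular (f k)) \<Longrightarrow> regular (\<lambda>x. \<Prod>k\<leftarrow>ks. f k x)"
  by (induction ks) (auto intro: regular_const regular_mult)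

lemma regular_coordinate2: "regular (\<lambda>B :: 'i \<Rightarrow> 'a \<Rightarrow> real. B i a)"
proof (rule regular_linear)
  have "continuous_on UNIV ((\<lambda>y. y a) \<circ> (\<lambda>B :: 'i \<Rightarrow> 'a \<Rightarrow> real. B i))"
    by (intro continuous_on_compose continuous_on_subset[OF continuous_on_product_coordinates]) auto
  then show "continuous_on UNIV (\<lambda>B :: 'i \<Rightarrow> 'a \<Rightarrow> real. B i a)" by (simp add: o_def)
qed (auto intro!: linearI simp: scaleR_fun_def)

lemma regular_coordinate3: "regular (\<lambda>B :: 'k \<Rightarrow> 'i \<Rightarrow> 'a \<Rightarrow> real. B k i a)"
proof (rule regular_linear)
  have "continuous_on UNIV ((\<lambda>y. y a) \<circ> (\<lambda>x. x i) \<circ> (\<lambda>B :: 'k \<Rightarrow> 'i \<Rightarrow> 'a \<Rightarrow> real. B k))"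
    by (intro continuous_on_compose continuous_on_subset[OF continuous_on_product_coordinates]) auto
  then show "continuous_on UNIV (\<lambda>B :: 'k \<Rightarrow> 'i \<Rightarrow> 'a \<Rightarrow> real. B k i a)" by (simp add: o_def)
qed (auto intro!: linearI simp: scaleR_fun_def)

text \<open>The value at \<open>s\<close> shows that the polynomial in \<open>t\<close> is not the
  zero polynomial, so it has finitely many roots.\<close>

lemma regular_zeros_on_line_finite:
  assumes "regular F" and "F (x + s *\<^sub>R (y - x)) \<noteq> 0"
  shows "finite {t. F (x + t *\<^sub>R (y - x)) = 0}"
proof -
  obtain a n where an: "\<And>t. F (x + t *\<^sub>R (y - x)) = (\<Sum>i\<le>n. a i * t ^ i)"
    using assms(1) unfolding regular_def real_polynomial_function_iff_sum by metis
  have "\<exists>i\<le>n. a i \<noteq> 0"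
  proof (rule ccontr)
    assume "\<not> ?thesis"
    then have "(\<Sum>i\<le>n. a i * s ^ i) = 0" by (intro sum.neutral) auto
    with assms(2) show False unfolding an by simp
  qed
  then obtain k where "k \<le> n" "a k \<noteq> 0" by blast
  then show ?thesis
    unfolding an by (auto intro: polyfun_rootbound_finite)
qed

lemma coord_space_expansion:
  assumes "y \<in> coord_space I" and "finite I"
  shows "y = (\<Sum>a\<in>I. y a *\<^sub>R (\<lambda>b. if b = a then 1 else 0))"
proof
  fix x show "y x = (\<Sum>a\<in>I. y a *\<^sub>R (\<lambda>b. if b = a then 1 else 0)) x"
    using assms by (cases "x \<in> I")
      (auto simp: coord_space_def sum_fun_apply scaleR_fun_def if_distrib[of "(*) _"] cong: if_cong)
qed

text \<open>\<open>F\<close> is the determinant of the matrix of a dual family of functionals for \<open>v x\<^sub>0\<close>, applied to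
  \<open>v x\<close>; at \<open>x\<^sub>0\<close> this matrix is the identity.\<close>

lemma independence_locus:
  fixes v :: "'b::{real_vector,topological_space} \<Rightarrow> 'i \<Rightarrow> 'a \<Rightarrow> real"
  assumes A: "finite A" and I: "finite I"
    and v0: "inj_on (v x\<^sub>0) A" "independent (v x\<^sub>0 ` A)" "\<And>i. i \<in> A \<Longrightarrow> v x\<^sub>0 i \<in> coord_space I"
    and reg: "\<And>i a. i \<in> A \<Longrightarrow> a \<in> I \<Longrightarrow> regular (\<lambda>x. v x i a)"
  obtains F where "regular F" "F x\<^sub>0 \<noteq> 0"
    "\<And>x. F x \<noteq> 0 \<Longrightarrow> inj_on (v x) A \<and> independent (v x ` A)"
proof -
  define n where "n = card A"
  obtain h where h: "bij_betw h {0..<n} A"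
    using ex_bij_betw_nat_finite[OF A] n_def by blast
  have hA: "h i \<in> A" if "i < n" for i using h that by (auto simp: bij_betw_def)
  have ex: "\<exists>g::('a \<Rightarrow> real) \<Rightarrow> real. linear g \<and>
      (\<forall>y\<in>v x\<^sub>0 ` A. g y = (if y = v x\<^sub>0 j then 1 else 0))" for j
    using v0(2) by (rule real_vector.linear_independent_extend)
  then have "\<forall>j. \<exists>g::('a \<Rightarrow> real) \<Rightarrow> real. linear g \<and>
      (\<forall>y\<in>v x\<^sub>0 ` A. g y = (if y = v x\<^sub>0 j then 1 else 0))" ..
  from choice[OF this] obtain g :: "'i \<Rightarrow> ('a \<Rightarrow> real) \<Rightarrow> real" where g: "\<And>j. linear (g j)"
    "\<And>j y. y \<in> v x\<^sub>0 ` A \<Longrightarrow> g j y = (if y = v x\<^sub>0 j then 1 else 0)"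
    by auto
  define e :: "'a \<Rightarrow> 'a \<Rightarrow> real" where "e a = (\<lambda>b. if b = a then 1 else 0)" for a
  have expand: "y = (\<Sum>a\<in>I. y a *\<^sub>R e a)" if "y \<in> coord_space I" for y
    unfolding e_def using that I by (rule coord_space_expansion)
  \<comment> \<open>The functionals \<open>g\<close> enter only through their values on unit
    vectors, which are constants, so the entries are regular even if \<open>g\<close> is not
    continuous. For \<open>x\<close> other than \<open>x\<^sub>0\<close>, the vectors may leave
    \<open>coord_space I\<close>, and the entries see only their coordinates in
    \<open>I\<close>.\<close>
  define M where "M x = mat n n (\<lambda>(j, i). \<Sum>a\<in>I. v x (h i) a * g (h j) (e a))" for x
  have M: "M x \<in> carrier_mat n n" for x by (simp add: M_def)
  have "M x\<^sub>0 = 1\<^sub>m n"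
  proof (rule eq_matI)
    fix j i assume "j < dim_row (1\<^sub>m n)" "i < dim_col (1\<^sub>m n)"
    then have ij: "i < n" "j < n" by auto
    have "g (h j) (v x\<^sub>0 (h i)) = (\<Sum>a\<in>I. v x\<^sub>0 (h i) a * g (h j) (e a))"
      by (subst expand[OF v0(3)[OF hA[OF ij(1)]]]) (simp add: linear_sum[OF g(1)] linear_scale[OF g(1)])
    moreover have "g (h j) (v x\<^sub>0 (h i)) = (if i = j then 1 else 0)"
      using g(2)[of "v x\<^sub>0 (h i)" "h j"] hA ij v0(1) h by (auto simp: inj_on_eq_iff bij_betw_def)
    ultimately show "M x\<^sub>0 $$ (j, i) = 1\<^sub>m n $$ (j, i)" using ij by (auto simp: M_def)
  qed (auto simp: M_def)
  then have 1: "det (M x\<^sub>0) \<noteq> 0" by simp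
  \<comment> \<open>These are the summands of the Leibniz formula for the determinant.\<close>
  have "regular (\<lambda>x. signof \<pi> * (\<Prod>j = 0..<n. M x $$ (j, \<pi> j)))" if "\<pi> permutes {0..<n}" for \<pi>
  proof (intro regular_mult regular_const regular_prod)
    fix j assume j: "j \<in> {0..<n}"
    then have "\<pi> j < n" using that permutes_in_image[of \<pi> "{0..<n}" j] by simp
    with j have "(\<lambda>x. M x $$ (j, \<pi> j)) = (\<lambda>x. \<Sum>a\<in>I. v x (h (\<pi> j)) a * g (h j) (e a))"
      by (simp add: M_def)
    then show "regular (\<lambda>x. M x $$ (j, \<pi> j))"
      using \<open>\<pi> j < n\<close> by (simp) (intro regular_sum regular_mult regular_const reg hA)
  qed
  then have 2: "regular (\<lambda>x. det (M x))"
    unfolding det_def'[OF M] by (intro regular_sum) auto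
  have 3: "inj_on (v x) A \<and> independent (v x ` A)" if "det (M x) \<noteq> 0" for x
    unfolding inj_on_independent_image_iff[OF A]
  proof (intro allI impI ballI)
    fix c k assume c: "(\<Sum>i\<in>A. c i *\<^sub>R v x i) = 0" and k: "k \<in> A"
    define z where "z = vec n (\<lambda>i. c (h i))"
    have coord: "(\<Sum>i = 0..<n. c (h i) * v x (h i) a) = 0" for a
    proof -
      have "(\<Sum>i = 0..<n. c (h i) * v x (h i) a) = (\<Sum>i\<in>A. c i * v x i a)"
        by (rule sum.reindex_bij_betw[OF h])
      also have "\<dots> = (\<Sum>i\<in>A. c i *\<^sub>R v x i) a" by (simp add: sum_fun_apply scaleR_fun_def)
      finally show ?thesis using c by simp
    qed
    \<comment> \<open>Column \<open>i\<close> of \<open>M x\<close> depends linearly on the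
      coordinates of \<open>v x (h i)\<close>, so a relation among the vectors is a relation among
      the columns.\<close>
    have "M x *\<^sub>v z = 0\<^sub>v n"
    proof (rule eq_vecI)
      fix j assume j: "j < dim_vec (0\<^sub>v n)"
      then have "(M x *\<^sub>v z) $ j = (\<Sum>i = 0..<n. (\<Sum>a\<in>I. v x (h i) a * g (h j) (e a)) * c (h i))"
        by (simp add: M_def z_def scalar_prod_def)
      also have "\<dots> = (\<Sum>a\<in>I. g (h j) (e a) * (\<Sum>i = 0..<n. c (h i) * v x (h i) a))"
        by (simp add: sum_distrib_left sum_distrib_right mult_ac) (rule sum.swap)
      finally show "(M x *\<^sub>v z) $ j = 0\<^sub>v n $ j" using j by (simp add: coord)
    qed (simp add: M_def)
    moreover have "z \<in> carrier_vec n" by (simp add: z_def)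
    ultimately have "z = 0\<^sub>v n"
      using that det_0_iff_vec_prod_zero[OF M, of x] by blast
    moreover obtain i where i: "i < n" "h i = k" using h k by (auto simp: bij_betw_def)
    moreover have "z $ i = c k" using i by (simp add: z_def)
    ultimately show "c k = 0" by simp
  qed
  show thesis by (rule that[OF 2 1 3])
qed

section \<open>Finite-dimensional coordinate spaces\<close>

text \<open>Finitely many unit vectors span, which bounds every independent set. Finiteness of
  \<open>C\<close> is recorded separately because infinite sets have \<open>card\<close> 0.\<close>

lemma finite_basis_exists:
  assumes "X \<subseteq> coord_space I" and "finite I"
  obtains C where "C \<subseteq> X" "independent C" "X \<subseteq> span C" "finite C" "card C = dim X"
proof -
  obtain C where C: "C \<subseteq> X" "independent C" "X \<subseteq> span C" "card C = dim X"
    by (rule real_vector.basis_exists)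
  let ?e = "\<lambda>a b. if b = a then 1 else 0 :: real"
  have "y \<in> span (?e ` I)" if "y \<in> coord_space I" for y
  proof -
    have "y = (\<Sum>a\<in>I. y a *\<^sub>R ?e a)"
      using that assms(2) by (rule coord_space_expansion)
    also have "\<dots> \<in> span (?e ` I)"
      by (intro span_sum span_scale span_base imageI)
    finally show ?thesis .
  qed
  then have "C \<subseteq> span (?e ` I)" using C(1) assms(1) by blast
  then have fin: "finite C"
    using real_vector.independent_span_bound[OF finite_imageI[OF assms(2)] C(2)] by blast
  show thesis by (rule that[OF C(1-3) fin C(4)])
qed

lemma card_le_dim:
  assumes "X \<subseteq> coord_space I" and "finite I" and "independent C" and "C \<subseteq> X"
  shows "card C \<le> dim X"
proof -
  obtain E where E: "E \<subseteq> X" "independent E" "X \<subseteq> span E" "finite E" "card E = dim X"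
    using finite_basis_exists[OF assms(1,2)] .
  have "C \<subseteq> span E" using assms(4) E(3) by (rule subset_trans)
  then show ?thesis
    using real_vector.independent_span_bound[OF E(4) assms(3)] E(5) by simp
qed

text \<open>A basis chosen inside \<open>S\<close> has at least as many elements as
  \<open>S\<close>, so it is all of \<open>S\<close>.\<close>

lemma independent_if_card_le_dim:
  fixes S :: "'v::real_vector set"
  assumes "finite S" and "card S \<le> dim S"
  shows "independent S"
proof -
  obtain C where C: "C \<subseteq> S" "independent C" "card C = dim S"
    by (rule real_vector.basis_exists)
  then have "C = S"
    using assms by (intro card_seteq) auto
  with C show ?thesis by simp
qed

text \<open>The images of a basis of \<open>S\<close> span the image, whose dimension is at least
  the size of the basis; hence they are distinct and independent, and no nonzero vector of the span
  is sent to zero.\<close>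

lemma inj_on_if_dim_image:
  assumes "linear f" and "S \<subseteq> coord_space I" and "finite I" and "dim S \<le> dim (f ` S)"
  shows "inj_on f (span S)"
proof -
  obtain C where C: "C \<subseteq> S" "independent C" "S \<subseteq> span C" "finite C" "card C = dim S"
    using finite_basis_exists[OF assms(2,3)] .
  have sub: "f ` S \<subseteq> span (f ` C)"
    using C(3) linear_span_image[OF assms(1)] by blast
  have "dim (f ` C) = dim (f ` S)"
    using sub C(1) real_vector.span_mono[of "f ` C" "f ` S"] real_vector.span_minimal[OF sub]
    by (intro real_vector.span_eq_dim) auto
  moreover have le: "card (f ` C) \<le> card C"
    using C by (intro card_image_le)
  ultimately have ind: "independent (f ` C)"
    using assms(4) C by (intro independent_if_card_le_dim) auto
  have "card C \<le> card (f ` C)"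
    using assms(4) C real_vector.dim_eq_card_independent[OF ind] \<open>dim (f ` C) = dim (f ` S)\<close> by simp
  then have "inj_on f C"
    using le C by (intro eq_card_imp_inj_on) auto
  moreover have "inj_on f (span C) \<longleftrightarrow> inj_on f C"
    using real_vector.linear_inj_on_span_iff_independent_image[OF assms(1) ind] .
  moreover have "span S \<subseteq> span C"
    using C(3) by (intro span_minimal) auto
  ultimately show ?thesis
    using inj_on_subset by blast
qed

section \<open>Tensorized subspaces as functions of the frames\<close>

lemma finite_sorted_tuples [simp]: "finite (sorted_tuples d p)"
  by (rule finite_subset[OF _ finite_lists_length_eq[of "{1..d}" p]]) (auto simp: sorted_tuples_def)

lemma tensor_power_in_RD: "tensor_power d p x \<in> RD d p"
  by (simp add: tensor_power_def coord_space_def)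

lemma tensorized_subspace_subset_RD: "tensorized_subspace d p V \<subseteq> RD d p"
  unfolding tensorized_subspace_def
  by (intro span_minimal subspace_coord_space) (auto intro: tensor_power_in_RD)

text \<open>Defined for arbitrary families \<open>B\<close>, not only for frames, so that it can be
  followed along lines that may leave the set of frames.\<close>

definition frames_dim :: "nat \<Rightarrow> nat \<Rightarrow> nat \<Rightarrow> nat \<Rightarrow> (nat \<Rightarrow> nat \<Rightarrow> nat \<Rightarrow> real) \<Rightarrow> nat"
  where "frames_dim m p r K B = dim (tensorized_subspace m p (\<Union>k\<in>{1..K}. frame_span r (B k)))"

text \<open>Lower semicontinuity of the dimension: a basis of tensor powers at
  \<open>B\<^sub>0\<close> stays independent, off the zeros of \<open>F\<close>, when the underlying
  vectors move with the frames.\<close>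

lemma frames_dim_locus:
  obtains F where "regular F" "F B\<^sub>0 \<noteq> 0"
    "\<forall>B. F B \<noteq> 0 \<longrightarrow> frames_dim m p r K B\<^sub>0 \<le> frames_dim m p r K B"
proof -
  let ?V = "\<lambda>B. \<Union>k\<in>{1..K}. frame_span r (B k)"
  have "tensor_power m p ` ?V B\<^sub>0 \<subseteq> RD m p" by (auto intro: tensor_power_in_RD)
  \<comment> \<open>The basis is taken among the tensor powers, not merely in their span, so each
    element comes from one vector of one subspace.\<close>
  then obtain C where C: "C \<subseteq> tensor_power m p ` ?V B\<^sub>0" "independent C" "finite C"
    "card C = dim (tensor_power m p ` ?V B\<^sub>0)"
    using finite_basis_exists[OF _ finite_sorted_tuples] by metis
  have "\<exists>k c. k \<in> {1..K} \<and> b = tensor_power m p (\<Sum>j=1..r. c j *\<^sub>R B\<^sub>0 k j)" if "b \<in> C" for b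
  proof -
    obtain k x where "k \<in> {1..K}" "x \<in> frame_span r (B\<^sub>0 k)" "b = tensor_power m p x"
      using \<open>b \<in> C\<close> C(1) by blast
    then show ?thesis unfolding frame_span_def in_span_image_finite_iff[OF finite_atLeastAtMost] by blast
  qed
  then obtain \<kappa> c where \<kappa>: "\<And>b. b \<in> C \<Longrightarrow> \<kappa> b \<in> {1..K}"
    and c: "\<And>b. b \<in> C \<Longrightarrow> b = tensor_power m p (\<Sum>j=1..r. c b j *\<^sub>R B\<^sub>0 (\<kappa> b) j)"
    by metis
  \<comment> \<open>The subspace index \<open>\<kappa> b\<close> and the coefficients
    \<open>c b\<close> stay as at \<open>B\<^sub>0\<close>; only the frame varies, which makes the
    coordinates polynomial in \<open>B\<close>.\<close>
  define v where "v B b = tensor_power m p (\<Sum>j=1..r. c b j *\<^sub>R B (\<kappa> b) j)"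
    for B :: "nat \<Rightarrow> nat \<Rightarrow> nat \<Rightarrow> real" and b
  have v0: "v B\<^sub>0 b = b" if "b \<in> C" for b
    using c[OF that] by (simp add: v_def)
  then have img: "v B\<^sub>0 ` C = C" and inj: "inj_on (v B\<^sub>0) C"
    by (auto simp: inj_on_def image_iff)
  have "regular (\<lambda>B. v B b ks)" if "ks \<in> sorted_tuples m p" for b ks
  proof -
    have "(\<lambda>B. v B b ks) = (\<lambda>B. \<Prod>k\<leftarrow>ks. \<Sum>j=1..r. c b j * B (\<kappa> b) j k)"
      using that unfolding v_def tensor_power_def
      by (simp add: fun_eq_iff sum_fun_apply scaleR_fun_def cong: map_cong)
    then show ?thesis
      by (simp only:) (intro regular_prod_list regular_sum regular_mult regular_const regular_coordinate3)
  qed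
  moreover have "v B\<^sub>0 b \<in> RD m p" for b
    unfolding v_def by (rule tensor_power_in_RD)
  ultimately obtain F where F: "regular F" "F B\<^sub>0 \<noteq> 0"
    "\<And>B. F B \<noteq> 0 \<Longrightarrow> inj_on (v B) C \<and> independent (v B ` C)"
    using independence_locus[where v = v and x\<^sub>0 = B\<^sub>0, OF C(3) finite_sorted_tuples[of m p] inj] C(2)
    unfolding img by blast
  have "frames_dim m p r K B\<^sub>0 \<le> frames_dim m p r K B" if "F B \<noteq> 0" for B
  proof -
    have "v B b \<in> tensorized_subspace m p (?V B)" if "b \<in> C" for b
      unfolding tensorized_subspace_def v_def using \<kappa>[OF that]
      by (intro span_base imageI UN_I[of "\<kappa> b"])
        (auto simp: frame_span_def intro!: span_sum span_scale intro: span_base)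
    then have "card (v B ` C) \<le> dim (tensorized_subspace m p (?V B))"
      using F(3)[OF that]
      by (intro card_le_dim[OF tensorized_subspace_subset_RD finite_sorted_tuples]) auto
    then show ?thesis
      using F(3)[OF that] C(4) by (simp add: card_image frames_dim_def tensorized_subspace_def)
  qed
  then show thesis using that[OF F(1,2)] by simp
qed

text \<open>The determinant handles independence. The other conditions on a frame are linear, so
  they persist on the line through two frames and can remain premises.\<close>

lemma frames_locus:
  assumes "B\<^sub>0 \<in> frames r d"
  obtains G where "regular G" "G B\<^sub>0 \<noteq> 0"
    "\<forall>B. G B \<noteq> 0 \<and> (\<forall>i\<in>{1..r}. B i \<in> Rn d) \<and> (\<forall>i. i \<notin> {1..r} \<longrightarrow> B i = 0) \<longrightarrow> B \<in> frames r d"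
proof -
  have ind: "inj_on B\<^sub>0 {1..r}" "independent (B\<^sub>0 ` {1..r})" "\<And>i. i \<in> {1..r} \<Longrightarrow> B\<^sub>0 i \<in> Rn d"
    using assms by (auto simp: frames_def)
  show thesis
  proof (rule independence_locus[where v = "\<lambda>B. B",
        OF finite_atLeastAtMost finite_atLeastAtMost ind regular_coordinate2])
    fix G :: "(nat \<Rightarrow> nat \<Rightarrow> real) \<Rightarrow> real"
    assume G: "regular G" "G B\<^sub>0 \<noteq> 0"
      and *: "\<And>B. G B \<noteq> 0 \<Longrightarrow> inj_on B {1..r} \<and> independent (B ` {1..r})"
    show thesis
    proof (rule that[OF G], intro allI impI)
      fix B :: "nat \<Rightarrow> nat \<Rightarrow> real"
      assume B: "G B \<noteq> 0 \<and> (\<forall>i\<in>{1..r}. B i \<in> Rn d) \<and> (\<forall>i. i \<notin> {1..r} \<longrightarrow> B i = 0)"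
      from *[OF conjunct1[OF this]] B show "B \<in> frames r d" unfolding frames_def by blast
    qed
  qed
qed

section \<open>Generic unions\<close>

lemma in_frame_span_iff: "x \<in> frame_span r B \<longleftrightarrow> (\<exists>c. x = (\<Sum>j=1..r. c j *\<^sub>R B j))"
  unfolding frame_span_def by (rule in_span_image_finite_iff) simp

lemma frame_in_frame_span: "i \<in> {1..r} \<Longrightarrow> B i \<in> frame_span r B"
  unfolding frame_span_def by (intro span_base imageI)

text \<open>Frames with the same span differ by a change of basis \<open>\<phi>\<close>, which acts continuously on all frames
  and preserves spans; so the saturation of an open set of frames is open.\<close>

lemma openin_frame_span_image:
  assumes "openin (top_of_set (frames r d)) W"
  shows "openin (Grassmannian_topology r d) (frame_span r ` W)"
proof -
  obtain T where T: "open T" "W = frames r d \<inter> T"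
    using assms by (auto simp: openin_open)
  let ?P = "{B \<in> frames r d. frame_span r B \<in> frame_span r ` W}"
  have "\<exists>N. openin (top_of_set (frames r d)) N \<and> B\<^sub>0 \<in> N \<and> N \<subseteq> ?P" if "B\<^sub>0 \<in> ?P" for B\<^sub>0
  proof -
    from that obtain C where C: "C \<in> W" "frame_span r C = frame_span r B\<^sub>0" and B0: "B\<^sub>0 \<in> frames r d"
      by force
    have CF: "C \<in> frames r d" using C T by blast
    have "\<exists>c. C i = (\<Sum>j=1..r. c j *\<^sub>R B\<^sub>0 j)" if "i \<in> {1..r}" for i
      using frame_in_frame_span[OF that, of C] unfolding C(2) in_frame_span_iff .
    \<comment> \<open>\<open>h\<close> and \<open>g\<close> are the matrices of the change of basis
      from \<open>B\<^sub>0\<close> to \<open>C\<close> and back.\<close>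
    then obtain h where h: "\<And>i. i \<in> {1..r} \<Longrightarrow> C i = (\<Sum>j=1..r. h i j *\<^sub>R B\<^sub>0 j)" by metis
    have "\<exists>c. B\<^sub>0 i = (\<Sum>j=1..r. c j *\<^sub>R C j)" if "i \<in> {1..r}" for i
      using frame_in_frame_span[OF that, of B\<^sub>0] unfolding C(2)[symmetric] in_frame_span_iff .
    then obtain g where g: "\<And>i. i \<in> {1..r} \<Longrightarrow> B\<^sub>0 i = (\<Sum>j=1..r. g i j *\<^sub>R C j)" by metis
    define \<phi> where "\<phi> B = (\<lambda>i. if i \<in> {1..r} then \<Sum>j=1..r. h i j *\<^sub>R B j else 0)"
      for B :: "nat \<Rightarrow> nat \<Rightarrow> real"
    have \<phi>_g: "(\<Sum>j=1..r. g i j *\<^sub>R \<phi> B j) = (\<Sum>k=1..r. (\<Sum>j=1..r. g i j * h j k) *\<^sub>R B k)" for i B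
    proof -
      have "(\<Sum>j=1..r. g i j *\<^sub>R \<phi> B j) = (\<Sum>j=1..r. \<Sum>k=1..r. (g i j * h j k) *\<^sub>R B k)"
        by (simp add: \<phi>_def scaleR_sum_right)
      also have "\<dots> = (\<Sum>k=1..r. \<Sum>j=1..r. (g i j * h j k) *\<^sub>R B k)"
        by (rule sum.swap)
      finally show ?thesis by (simp add: scaleR_sum_left)
    qed
    have "\<phi> B\<^sub>0 = C"
    proof
      fix i show "\<phi> B\<^sub>0 i = C i"
      proof (cases "i \<in> {1..r}")
        case True
        then show ?thesis unfolding \<phi>_def using h[OF True] by simp
      next
        case False
        then have "C i = 0" using CF unfolding frames_def by blast
        then show ?thesis unfolding \<phi>_def using False by (simp only: if_False)
      qed
    qed
    \<comment> \<open>The product of \<open>g\<close> and \<open>h\<close> is the identity because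
      \<open>B\<^sub>0\<close> is independent. As a statement about matrices alone it then applies
      to every \<open>B\<close>, and so \<open>\<phi>\<close> preserves all spans.\<close>
    have \<delta>: "(\<Sum>j=1..r. g i j * h j k) = (if k = i then 1 else 0)"
      if "i \<in> {1..r}" "k \<in> {1..r}" for i k
    proof -
      have "(\<Sum>k=1..r. ((\<Sum>j=1..r. g i j * h j k) - (if k = i then 1 else 0)) *\<^sub>R B\<^sub>0 k)
          = (\<Sum>j=1..r. g i j *\<^sub>R \<phi> B\<^sub>0 j) - (\<Sum>k=1..r. (if k = i then 1 else 0) *\<^sub>R B\<^sub>0 k)"
        unfolding \<phi>_g by (simp only: scaleR_diff_left sum_subtractf)
      also have "(\<Sum>k=1..r. (if k = i then 1 else 0) *\<^sub>R B\<^sub>0 k) = B\<^sub>0 i"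
        using that by (simp add: if_distrib[of "\<lambda>c. c *\<^sub>R _"] cong: if_cong)
      also have "(\<Sum>j=1..r. g i j *\<^sub>R \<phi> B\<^sub>0 j) = B\<^sub>0 i"
        using g[OF that(1)] \<open>\<phi> B\<^sub>0 = C\<close> by simp
      finally have 0: "(\<Sum>k=1..r. ((\<Sum>j=1..r. g i j * h j k) - (if k = i then 1 else 0)) *\<^sub>R B\<^sub>0 k) = 0"
        by (simp only: diff_self)
      have "inj_on B\<^sub>0 {1..r} \<and> independent (B\<^sub>0 ` {1..r})"
        using B0 by (simp add: frames_def)
      from this[unfolded inj_on_independent_image_iff[OF finite_atLeastAtMost], rule_format, OF 0 that(2)]
      show ?thesis by simp
    qed
    have span_eq: "frame_span r (\<phi> B) = frame_span r B" for B
    proof -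
      have "\<phi> B i \<in> span (B ` {1..r})" if "i \<in> {1..r}" for i
        unfolding \<phi>_def if_P[OF that] by (intro span_sum span_scale span_base imageI)
      moreover have "B i \<in> span (\<phi> B ` {1..r})" if "i \<in> {1..r}" for i
      proof -
        have "B i = (\<Sum>k=1..r. (if k = i then 1 else 0) *\<^sub>R B k)"
          using that by (simp add: if_distrib[of "\<lambda>c. c *\<^sub>R _"] cong: if_cong)
        also have "\<dots> = (\<Sum>j=1..r. g i j *\<^sub>R \<phi> B j)"
          unfolding \<phi>_g using \<delta>[OF that] by (intro sum.cong) auto
        also have "\<dots> \<in> span (\<phi> B ` {1..r})"
          by (intro span_sum span_scale span_base imageI)
        finally show ?thesis .
      qed
      ultimately show ?thesis
        unfolding frame_span_def by (intro subset_antisym span_minimal subspace_span image_subsetI)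
    qed
    have \<phi>_frame: "\<phi> B \<in> frames r d" if B: "B \<in> frames r d" for B
    proof -
      have "dim (\<phi> B ` {1..r}) = r"
        using frame_span_in_Grassmannian[OF B] unfolding span_eq[of B, symmetric]
        by (simp add: Grassmannian_def frame_span_def)
      moreover have le: "card (\<phi> B ` {1..r}) \<le> r"
        using card_image_le[of "{1..r}" "\<phi> B"] by simp
      ultimately have ind: "independent (\<phi> B ` {1..r})"
        by (intro independent_if_card_le_dim) auto
      then have "card (\<phi> B ` {1..r}) = r"
        using \<open>dim (\<phi> B ` {1..r}) = r\<close> by (simp add: real_vector.dim_eq_card_independent)
      then have "inj_on (\<phi> B) {1..r}"
        by (intro eq_card_imp_inj_on) auto
      moreover have "\<phi> B i \<in> Rn d" if "i \<in> {1..r}" for i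
        using frame_span_in_Grassmannian[OF B] frame_in_frame_span[OF that, of "\<phi> B"]
        unfolding span_eq Grassmannian_def by blast
      moreover have "\<phi> B i = 0" if "i \<notin> {1..r}" for i
        unfolding \<phi>_def using that by (rule if_not_P)
      ultimately show ?thesis
        using ind unfolding frames_def by blast
    qed
    have "continuous_on UNIV (\<lambda>B. \<phi> B i a)" for i a
    proof (cases "i \<in> {1..r}")
      case True
      then have "(\<lambda>B. \<phi> B i a) = (\<lambda>B. \<Sum>j=1..r. h i j * B j a)"
        by (auto simp: \<phi>_def fun_eq_iff sum_fun_apply scaleR_fun_def)
      moreover have "regular (\<lambda>B :: nat \<Rightarrow> nat \<Rightarrow> real. \<Sum>j=1..r. h i j * B j a)"
        by (intro regular_sum regular_mult regular_const regular_coordinate2)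
      ultimately show ?thesis unfolding regular_def by (simp only:)
    next
      case False
      then have "\<phi> B i a = 0" for B unfolding \<phi>_def by (simp only: if_False zero_fun_apply)
      then show ?thesis by simp
    qed
    then have "continuous_on UNIV \<phi>"
      by (intro continuous_on_coordinatewise_then_product)
    then have "open (\<phi> -` T)"
      using T(1) by (simp add: open_vimage)
    \<comment> \<open>This preimage is the required neighbourhood: it contains
      \<open>B\<^sub>0\<close>, and each of its frames has the same span as a frame in
      \<open>W\<close>.\<close>
    then have "openin (top_of_set (frames r d)) (frames r d \<inter> \<phi> -` T)"
      by (auto simp: openin_open)
    moreover have "B\<^sub>0 \<in> frames r d \<inter> \<phi> -` T"
      using B0 \<open>\<phi> B\<^sub>0 = C\<close> C(1) T(2) by auto
    moreover have "frames r d \<inter> \<phi> -` T \<subseteq> ?P"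
    proof
      fix B assume "B \<in> frames r d \<inter> \<phi> -` T"
      then have "B \<in> frames r d" "\<phi> B \<in> W" using \<phi>_frame T(2) by auto
      then show "B \<in> ?P" using imageI[of "\<phi> B" W "frame_span r"] by (simp add: span_eq)
    qed
    ultimately show ?thesis by blast
  qed
  then have "openin (top_of_set (frames r d)) ?P"
    by (subst openin_subopen) blast
  moreover have "frame_span r ` W \<subseteq> Grassmannian r d"
    using T(2) frame_span_in_Grassmannian by blast
  ultimately show ?thesis
    by (simp add: openin_Grassmannian_topology)
qed

lemma Grassmannian_frame_exists:
  assumes "r \<ge> 1" and "U \<in> Grassmannian r d"
  obtains B where "B \<in> frames r d" "frame_span r B = U"
proof -
  have "U \<in> frame_span r ` frames r d"
    using quotient_imp_surjective_map[OF quotient_map_frame_span[OF assms(1), of d]] assms(2) by simp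
  then show thesis using that by (elim imageE) simp
qed

lemma frames_nonempty:
  assumes "r \<le> d" shows "frames r d \<noteq> {}"
proof -
  \<comment> \<open>The first \<open>r\<close> unit vectors, which lie in \<open>Rn d\<close> by
    \<open>r \<le> d\<close>.\<close>
  define B :: "nat \<Rightarrow> nat \<Rightarrow> real"
    where "B i = (\<lambda>a. if i \<in> {1..r} \<and> a = i then 1 else 0)" for i
  have "inj_on B {1..r} \<and> independent (B ` {1..r})"
    unfolding inj_on_independent_image_iff[OF finite_atLeastAtMost]
  proof (intro allI impI ballI)
    fix c i assume 0: "(\<Sum>i=1..r. c i *\<^sub>R B i) = 0" and i: "i \<in> {1..r}"
    have "c i = (\<Sum>j=1..r. c j *\<^sub>R B j) i"
      using i by (simp add: sum_fun_apply scaleR_fun_def B_def if_distrib[of "(*) _"] cong: if_cong)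
    then show "c i = 0" unfolding 0 by simp
  qed
  moreover have "B i \<in> Rn d" if "i \<in> {1..r}" for i
    using that assms by (auto simp: B_def coord_space_def)
  moreover have "B i = 0" if "i \<notin> {1..r}" for i
    using that unfolding B_def by (simp only: simp_thms if_False zero_fun_def)
  ultimately have "B \<in> frames r d" unfolding frames_def by blast
  then show ?thesis by blast
qed

section \<open>Calculus of generic properties\<close>

lemma generic_unionE:
  assumes "generic_union d K r P"
  obtains \<O> where "openin (Grassmannian_power d K r) \<O>"
    "(Grassmannian_power d K r) closure_of \<O> = topspace (Grassmannian_power d K r)"
    "\<forall>U\<in>\<O>. P (\<Union>k\<in>{1..K}. U k)"
  using assms unfolding generic_union_def by (elim exE conjE)

lemma generic_unionI:
  assumes "openin (Grassmannian_power d K r) \<O>"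
    and "(Grassmannian_power d K r) closure_of \<O> = topspace (Grassmannian_power d K r)"
    and "\<And>U. U \<in> \<O> \<Longrightarrow> P (\<Union>k\<in>{1..K}. U k)"
  shows "generic_union d K r P"
  unfolding generic_union_def by (intro exI[of _ \<O>] conjI ballI assms)

lemma generic_union_mono:
  assumes "generic_union d K r P"
    and "\<And>U. U \<in> topspace (Grassmannian_power d K r) \<Longrightarrow> P (\<Union>k\<in>{1..K}. U k) \<Longrightarrow> Q (\<Union>k\<in>{1..K}. U k)"
  shows "generic_union d K r Q"
proof (rule generic_unionE[OF assms(1)])
  fix \<O> assume \<O>: "openin (Grassmannian_power d K r) \<O>"
    "(Grassmannian_power d K r) closure_of \<O> = topspace (Grassmannian_power d K r)"
    and P: "\<forall>U\<in>\<O>. P (\<Union>k\<in>{1..K}. U k)"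
  show ?thesis
    using \<O> by (rule generic_unionI) (use P assms(2) openin_subset[OF \<O>(1)] in blast)
qed

text \<open>Two open dense sets have a dense intersection: \<open>T\<close> meets an open
  \<open>W\<close> in a nonempty open set, which \<open>S\<close> then meets.\<close>

lemma generic_union_conj:
  assumes "generic_union d K r P" and "generic_union d K r Q"
  shows "generic_union d K r (\<lambda>V. P V \<and> Q V)"
proof -
  let ?X = "Grassmannian_power d K r"
  obtain S where S: "openin ?X S" "?X closure_of S = topspace ?X" "\<forall>U\<in>S. P (\<Union>k\<in>{1..K}. U k)"
    by (rule generic_unionE[OF assms(1)])
  obtain T where T: "openin ?X T" "?X closure_of T = topspace ?X" "\<forall>U\<in>T. Q (\<Union>k\<in>{1..K}. U k)"
    by (rule generic_unionE[OF assms(2)])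
  have "openin ?X (S \<inter> T)" using S(1) T(1) by (rule openin_Int)
  moreover have "?X closure_of (S \<inter> T) = topspace ?X"
    unfolding dense_intersects_open
  proof (intro allI impI)
    fix W assume W: "openin ?X W \<and> W \<noteq> {}"
    then have "T \<inter> W \<noteq> {}" "openin ?X (T \<inter> W)"
      using T(1,2) unfolding dense_intersects_open by (simp_all add: openin_Int)
    then have "S \<inter> (T \<inter> W) \<noteq> {}"
      using S(2) unfolding dense_intersects_open by simp
    then show "S \<inter> T \<inter> W \<noteq> {}" by (simp add: Int_assoc)
  qed
  ultimately show ?thesis
    by (rule generic_unionI) (use S(3) T(3) in simp)
qed

lemma generic_union_ball:
  assumes "finite I" and "\<And>i. i \<in> I \<Longrightarrow> generic_union d K r (P i)"
  shows "generic_union d K r (\<lambda>V. \<forall>i\<in>I. P i V)"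
  using assms
proof (induction I)
  case empty
  show ?case
    by (rule generic_unionI[OF openin_topspace closure_of_topspace]) simp
next
  case (insert i I)
  then have "generic_union d K r (\<lambda>V. P i V \<and> (\<forall>i\<in>I. P i V))"
    by (intro generic_union_conj) auto
  then show ?case by simp
qed

text \<open>The condition \<open>r \<le> d\<close> makes the product of Grassmannians nonempty, so
  that a dense set cannot be empty.\<close>

lemma generic_union_ex:
  assumes "generic_union d K r P" and "r \<le> d"
  obtains U where "U \<in> topspace (Grassmannian_power d K r)" "P (\<Union>k\<in>{1..K}. U k)"
proof -
  obtain B where "B \<in> frames r d" using frames_nonempty[OF assms(2)] by blast
  then have ne: "restrict (\<lambda>_. frame_span r B) {1..K} \<in> topspace (Grassmannian_power d K r)"
    using frame_span_in_Grassmannian by simp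
  obtain \<O> where O: "openin (Grassmannian_power d K r) \<O>"
    "(Grassmannian_power d K r) closure_of \<O> = topspace (Grassmannian_power d K r)"
    "\<forall>U\<in>\<O>. P (\<Union>k\<in>{1..K}. U k)"
    by (rule generic_unionE[OF assms(1)])
  have "\<O> \<noteq> {}" using O(2) ne by (metis closure_of_empty empty_iff)
  then obtain U where "U \<in> \<O>" by blast
  then show thesis using O(3) openin_subset[OF O(1)] by (intro that[of U]) auto
qed

section \<open>Openness and density of the tuples with large tensor dimension\<close>

lemma open_contains_box:
  fixes S :: "('i \<Rightarrow> 'b::topological_space) set"
  assumes "open S" and "x \<in> S"
  obtains X where "\<forall>i. open (X i)" "\<forall>i. x i \<in> X i" "\<forall>y. (\<forall>i. y i \<in> X i) \<longrightarrow> y \<in> S"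
proof -
  have "openin (product_topology (\<lambda>_. euclidean) UNIV) S"
    using assms(1) by (simp add: open_fun_def)
  from product_topology_open_contains_basis[OF this assms(2)] obtain X
    where X: "x \<in> (\<Pi>\<^sub>E i\<in>UNIV. X i)" "\<forall>i. openin euclidean (X i)" "(\<Pi>\<^sub>E i\<in>UNIV. X i) \<subseteq> S"
    by auto
  show thesis
  proof (rule that)
    show "\<forall>i. open (X i)" using X(2) by simp
    show "\<forall>i. x i \<in> X i" using X(1) by (simp add: PiE_iff)
    show "\<forall>y. (\<forall>i. y i \<in> X i) \<longrightarrow> y \<in> S" using X(3) by (simp add: subset_iff PiE_iff)
  qed
qed

text \<open>Semicontinuity holds on a box of families of frames. Its factors have open images in the
  Grassmannian, and finitely many of these form an open box around \<open>U\<close>.\<close>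

lemma openin_frames_dim_ge:
  assumes "r \<ge> 1"
  shows "openin (Grassmannian_power d K r) {U \<in> topspace (Grassmannian_power d K r).
    N \<le> dim (tensorized_subspace m p (\<Union>k\<in>{1..K}. U k))}" (is "openin ?X ?\<O>")
proof (subst openin_subopen, intro ballI)
  fix U assume U: "U \<in> ?\<O>"
  have "\<exists>B. k \<in> {1..K} \<longrightarrow> B \<in> frames r d \<and> frame_span r B = U k" for k
  proof (cases "k \<in> {1..K}")
    case True
    then have "U k \<in> Grassmannian r d" using U by auto
    then show ?thesis by (rule Grassmannian_frame_exists[OF assms]) blast
  qed blast
  then obtain B where B: "\<And>k. k \<in> {1..K} \<Longrightarrow> B k \<in> frames r d \<and> frame_span r (B k) = U k"
    by metis
  obtain F where F: "regular F" "F B \<noteq> 0"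
    "\<forall>B'. F B' \<noteq> 0 \<longrightarrow> frames_dim m p r K B \<le> frames_dim m p r K B'"
    by (rule frames_dim_locus[where B\<^sub>0 = B and m = m and p = p and r = r and K = K])
  have "open {B'. F B' \<noteq> 0}"
    using F(1) by (intro open_Collect_neq) (auto simp: regular_def)
  then obtain T where T: "\<forall>k. open (T k)" "\<forall>k. B k \<in> T k"
    "\<forall>B'. (\<forall>k. B' k \<in> T k) \<longrightarrow> B' \<in> {B'. F B' \<noteq> 0}"
    by (rule open_contains_box[where x = B]) (use F(2) in simp)
  define W where "W k = frame_span r ` (frames r d \<inter> T k)" for k
  let ?box = "\<Pi>\<^sub>E k\<in>{1..K}. W k"
  have "openin (Grassmannian_topology r d) (W k)" for k
    unfolding W_def by (intro openin_frame_span_image) (simp add: openin_open_Int T(1))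
  then have "openin ?X ?box"
    by (simp add: openin_PiE)
  moreover have "U \<in> ?box"
  proof (rule PiE_I)
    fix k assume "k \<in> {1..K}"
    then show "U k \<in> W k" using B[of k] spec[OF T(2), of k] unfolding W_def by blast
  next
    fix k assume "k \<notin> {1..K}"
    then show "U k = undefined" using U by (auto simp: PiE_iff extensional_def)
  qed
  moreover have "?box \<subseteq> ?\<O>"
  proof
    fix U' assume U': "U' \<in> ?box"
    \<comment> \<open>Membership in the box concerns every index, so outside \<open>{1..K}\<close>
      any point of \<open>T k\<close> is taken; the union does not involve it.\<close>
    have "\<exists>B'. B' \<in> T k \<and> (k \<in> {1..K} \<longrightarrow> frame_span r B' = U' k)" for k
    proof (cases "k \<in> {1..K}")
      case True
      then have "U' k \<in> W k" using U' by (rule PiE_mem[rotated])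
      then show ?thesis unfolding W_def by blast
    qed (use T(2) in blast)
    then obtain B' where B': "\<And>k. B' k \<in> T k" "\<And>k. k \<in> {1..K} \<Longrightarrow> frame_span r (B' k) = U' k"
      by metis
    have "frames_dim m p r K B \<le> frames_dim m p r K B'"
      using T(3) B'(1) F(3) by simp
    moreover have "(\<Union>k\<in>{1..K}. frame_span r (B k)) = (\<Union>k\<in>{1..K}. U k)"
      using B by (intro SUP_cong) auto
    moreover have "(\<Union>k\<in>{1..K}. frame_span r (B' k)) = (\<Union>k\<in>{1..K}. U' k)"
      using B' by (intro SUP_cong) auto
    ultimately have "N \<le> dim (tensorized_subspace m p (\<Union>k\<in>{1..K}. U' k))"
      using U by (simp add: frames_dim_def)
    moreover have "U' \<in> topspace ?X"
      using U' \<open>openin ?X ?box\<close> openin_subset by blast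
    ultimately show "U' \<in> ?\<O>" by simp
  qed
  ultimately show "\<exists>T. openin ?X T \<and> U \<in> T \<and> T \<subseteq> ?\<O>" by blast
qed

text \<open>A finite set of zeros has no limit point, even if 0 is itself a zero.\<close>

lemma eventually_regular_nonzero_on_line:
  assumes "regular F" and "F (x + s *\<^sub>R (y - x)) \<noteq> 0"
  shows "\<forall>\<^sub>F t in at 0. F (x + t *\<^sub>R (y - x)) \<noteq> 0"
proof -
  have "\<not> (0::real) islimpt {t. F (x + t *\<^sub>R (y - x)) = 0}"
    using regular_zeros_on_line_finite[OF assms] by (rule islimpt_finite)
  then show ?thesis by (simp add: islimpt_iff_eventually)
qed

lemma continuous_on_line:
  fixes B C :: "nat \<Rightarrow> nat \<Rightarrow> real"
  shows "continuous_on UNIV (\<lambda>t. B + t *\<^sub>R (C - B))"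
  by (intro continuous_on_coordinatewise_then_product)
    (simp add: scaleR_fun_def, intro continuous_intros)

text \<open>On the line from frames of a given tuple to frames of \<open>Us\<close>, all but finitely many points
  are frames and attain at least the dimension of \<open>Us\<close>.\<close>

lemma dense_frames_dim_ge:
  assumes "r \<ge> 1" and Us: "Us \<in> topspace (Grassmannian_power d K r)"
  shows "(Grassmannian_power d K r) closure_of {U \<in> topspace (Grassmannian_power d K r).
      dim (tensorized_subspace m p (\<Union>k\<in>{1..K}. Us k)) \<le> dim (tensorized_subspace m p (\<Union>k\<in>{1..K}. U k))}
    = topspace (Grassmannian_power d K r)" (is "?X closure_of ?\<O> = _")
  unfolding dense_intersects_open
proof (intro allI impI)
  fix T assume T: "openin ?X T \<and> T \<noteq> {}"
  then obtain U where U: "U \<in> T" by blast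
  have Utop: "U \<in> topspace ?X" using T U openin_subset by blast
  have choose: "\<exists>B. k \<in> {1..K} \<longrightarrow> B \<in> frames r d \<and> frame_span r B = V k"
    if "V \<in> topspace ?X" for V k
  proof (cases "k \<in> {1..K}")
    case True
    then have "V k \<in> Grassmannian r d" using that by auto
    then show ?thesis by (rule Grassmannian_frame_exists[OF assms(1)]) blast
  qed blast
  obtain B where B: "\<And>k. k \<in> {1..K} \<Longrightarrow> B k \<in> frames r d \<and> frame_span r (B k) = U k"
    using choose[OF Utop] by metis
  obtain C where C: "\<And>k. k \<in> {1..K} \<Longrightarrow> C k \<in> frames r d \<and> frame_span r (C k) = Us k"
    using choose[OF Us] by metis
  from product_topology_open_contains_basis[OF conjunct1[OF T] U] obtain W
    where W: "U \<in> (\<Pi>\<^sub>E k\<in>{1..K}. W k)" "\<forall>k. openin (Grassmannian_topology r d) (W k)"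
      "(\<Pi>\<^sub>E k\<in>{1..K}. W k) \<subseteq> T"
    by auto
  \<comment> \<open>The line starts at the frames \<open>B\<close> of the given \<open>U\<close> and
    reaches the frames \<open>C\<close> of \<open>Us\<close> at \<open>t = 1\<close>.\<close>
  define L where "L t = B + t *\<^sub>R (C - B)" for t :: real
  have L: "L t k = B k + t *\<^sub>R (C k - B k)" for t k
    by (simp add: L_def scaleR_fun_def)
  obtain F where F: "regular F" "F C \<noteq> 0"
    "\<forall>B'. F B' \<noteq> 0 \<longrightarrow> frames_dim m p r K C \<le> frames_dim m p r K B'"
    by (rule frames_dim_locus[where B\<^sub>0 = C and m = m and p = p and r = r and K = K])
  \<comment> \<open>One nonzero value, at the far end \<open>t = 1\<close>, suffices for all small
    nonzero \<open>t\<close>.\<close>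
  have "\<forall>\<^sub>F t in at 0. F (L t) \<noteq> 0"
    unfolding L_def by (rule eventually_regular_nonzero_on_line[OF F(1), of B 1 C]) (use F(2) in simp)
  moreover have "\<forall>\<^sub>F t in at 0. \<forall>k\<in>{1..K}. L t k \<in> frames r d"
  proof (intro eventually_ball_finite ballI finite_atLeastAtMost)
    fix k assume k: "k \<in> {1..K}"
    obtain G where G: "regular G" "G (B k) \<noteq> 0"
      "\<forall>B'. G B' \<noteq> 0 \<and> (\<forall>i\<in>{1..r}. B' i \<in> Rn d) \<and> (\<forall>i. i \<notin> {1..r} \<longrightarrow> B' i = 0) \<longrightarrow> B' \<in> frames r d"
      using conjunct1[OF B[OF k]] by (rule frames_locus)
    have Bk: "B k \<in> frames r d" and Ck: "C k \<in> frames r d"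
      using B[OF k] C[OF k] by auto
    have "\<forall>\<^sub>F t in at 0. G (L t k) \<noteq> 0"
      unfolding L by (rule eventually_regular_nonzero_on_line[OF G(1), of "B k" 0 "C k"]) (use G(2) in simp)
    then show "\<forall>\<^sub>F t in at 0. L t k \<in> frames r d"
    proof (rule eventually_mono)
      fix t assume "G (L t k) \<noteq> 0"
      moreover have "L t k i \<in> Rn d" if "i \<in> {1..r}" for i
      proof -
        have "B k i \<in> Rn d" "C k i \<in> Rn d" using Bk Ck that unfolding frames_def by blast+
        then show ?thesis
          unfolding L by (simp add: scaleR_fun_def coord_space_def)
      qed
      moreover have "L t k i = 0" if "i \<notin> {1..r}" for i
      proof -
        have "B k i = 0" "C k i = 0" using Bk Ck that unfolding frames_def by blast+
        then show ?thesis
          unfolding L by (simp add: scaleR_fun_def fun_eq_iff)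
      qed
      ultimately show "L t k \<in> frames r d" using G(3) by blast
    qed
  qed
  \<comment> \<open>Continuity of the line at 0. The implication appears because the preimage of
    \<open>W k\<close> is open only relative to the frames.\<close>
  moreover have "\<forall>\<^sub>F t in at 0. \<forall>k\<in>{1..K}. L t k \<in> frames r d \<longrightarrow> frame_span r (L t k) \<in> W k"
  proof (intro eventually_ball_finite ballI finite_atLeastAtMost)
    fix k assume k: "k \<in> {1..K}"
    have "openin (top_of_set (frames r d)) {B \<in> frames r d. frame_span r B \<in> W k}"
      using W(2) by (simp add: openin_Grassmannian_topology)
    then obtain Y where Y: "open Y" "{B \<in> frames r d. frame_span r B \<in> W k} = frames r d \<inter> Y"
      unfolding openin_open by metis
    have "B k \<in> {B \<in> frames r d. frame_span r B \<in> W k}"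
      using B[OF k] W(1) k by (auto simp: PiE_iff)
    then have "B k \<in> Y" unfolding Y(2) by blast
    have "open ((\<lambda>t. L t k) -` Y)"
      unfolding L using Y(1) continuous_on_line by (intro open_vimage)
    moreover have "0 \<in> (\<lambda>t. L t k) -` Y" using \<open>B k \<in> Y\<close> by (simp add: L)
    ultimately have "\<forall>\<^sub>F t in at 0. t \<in> (\<lambda>t. L t k) -` Y"
      by (rule eventually_at_in_open')
    then show "\<forall>\<^sub>F t in at 0. L t k \<in> frames r d \<longrightarrow> frame_span r (L t k) \<in> W k"
      by (rule eventually_mono) (use Y(2) in blast)
  qed
  ultimately have "\<forall>\<^sub>F t in at (0::real). F (L t) \<noteq> 0 \<and>
      (\<forall>k\<in>{1..K}. L t k \<in> frames r d \<and> frame_span r (L t k) \<in> W k)"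
    by eventually_elim blast
  from eventually_happens'[OF at_neq_bot this]
  obtain t where t: "F (L t) \<noteq> 0" "\<forall>k\<in>{1..K}. L t k \<in> frames r d \<and> frame_span r (L t k) \<in> W k"
    by (elim exE conjE)
  define U' where "U' = restrict (\<lambda>k. frame_span r (L t k)) {1..K}"
  have "U' \<in> (\<Pi>\<^sub>E k\<in>{1..K}. W k)"
    unfolding U'_def restrict_PiE_iff using t(2) by blast
  then have "U' \<in> T" using W(3) by blast
  have "frames_dim m p r K C \<le> frames_dim m p r K (L t)"
    using F(3) t(1) by blast
  moreover have "(\<Union>k\<in>{1..K}. frame_span r (C k)) = (\<Union>k\<in>{1..K}. Us k)"
    using C by (intro SUP_cong) auto
  moreover have "(\<Union>k\<in>{1..K}. frame_span r (L t k)) = (\<Union>k\<in>{1..K}. U' k)"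
    by (intro SUP_cong) (auto simp: U'_def)
  moreover have "U' \<in> topspace ?X"
    using \<open>U' \<in> T\<close> T openin_subset[of ?X T] by blast
  ultimately have "U' \<in> ?\<O>" by (simp add: frames_dim_def)
  with \<open>U' \<in> T\<close> show "?\<O> \<inter> T \<noteq> {}" by blast
qed

text \<open>Bounded dimensions have a maximum, attained at some \<open>Us\<close>; the tuples
  attaining it form an open dense set. Keeping \<open>m\<close> apart from \<open>d\<close> allows
  subspaces of \<open>Rn d\<close> to be tensorized in their first \<open>m\<close> coordinates
  only.\<close>

lemma generic_dim_tensorized_subspace:
  assumes "r \<ge> 1" and "r \<le> d"
  obtains Us where "Us \<in> topspace (Grassmannian_power d K r)"
    "\<forall>U\<in>topspace (Grassmannian_power d K r).
      dim (tensorized_subspace m p (\<Union>k\<in>{1..K}. U k)) \<le> dim (tensorized_subspace m p (\<Union>k\<in>{1..K}. Us k))"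
    "generic_union d K r (\<lambda>V. dim (tensorized_subspace m p V) = dim (tensorized_subspace m p (\<Union>k\<in>{1..K}. Us k)))"
proof -
  let ?X = "Grassmannian_power d K r"
  define Q where "Q U = dim (tensorized_subspace m p (\<Union>k\<in>{1..K}. U k))" for U :: "nat \<Rightarrow> (nat \<Rightarrow> real) set"
  obtain B where "B \<in> frames r d" using frames_nonempty[OF assms(2)] by blast
  then have ne: "restrict (\<lambda>_. frame_span r B) {1..K} \<in> topspace ?X"
    using frame_span_in_Grassmannian by simp
  obtain E where E: "RD m p \<subseteq> span E" "finite E"
    by (rule finite_basis_exists[OF subset_refl finite_sorted_tuples])
  have "Q U \<le> card E" for U
    unfolding Q_def using tensorized_subspace_subset_RD E
    by (intro real_vector.dim_le_card) (rule subset_trans)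
  then have "Q ` topspace ?X \<subseteq> {..card E}" by blast
  then have fin: "finite (Q ` topspace ?X)" by (rule finite_subset) simp
  define N where "N = Max (Q ` topspace ?X)"
  have "N \<in> Q ` topspace ?X"
    unfolding N_def using fin ne by (intro Max_in) blast+
  then obtain Us where Us: "N = Q Us" "Us \<in> topspace ?X" by (rule imageE)
  have le: "\<forall>U\<in>topspace ?X. Q U \<le> Q Us"
    unfolding Us(1)[symmetric] N_def using fin by (intro ballI Max_ge imageI)
  have "generic_union d K r (\<lambda>V. dim (tensorized_subspace m p V) = Q Us)"
  proof (rule generic_unionI)
    show "openin ?X {U \<in> topspace ?X. Q Us \<le> Q U}"
      unfolding Q_def by (rule openin_frames_dim_ge[OF assms(1)])
    show "?X closure_of {U \<in> topspace ?X. Q Us \<le> Q U} = topspace ?X"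
      unfolding Q_def by (rule dense_frames_dim_ge[OF assms(1) Us(2)])
  next
    fix U assume "U \<in> {U \<in> topspace ?X. Q Us \<le> Q U}"
    then have "Q U = Q Us" using le by (auto intro: antisym)
    then show "dim (tensorized_subspace m p (\<Union>k\<in>{1..K}. U k)) = Q Us" by (simp add: Q_def)
  qed
  with Us(2) le show thesis unfolding Q_def by (rule that)
qed

text \<open>Two generic values are attained simultaneously at some tuple, so they agree and the
  definite description is justified.\<close>

lemma generic_dim_eqI:
  assumes "generic_union d K r (\<lambda>V. dim (tensorized_subspace d p V) = n)" and "r \<le> d"
  shows "generic_dim d K r p = n"
  unfolding generic_dim_def
proof (rule the_equality)
  fix n' assume "generic_union d K r (\<lambda>V. dim (tensorized_subspace d p V) = n')"
  from generic_union_ex[OF generic_union_conj[OF assms(1) this] assms(2)]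
  show "n' = n" by metis
qed (rule assms(1))

section \<open>Restriction of tensors and identifiability\<close>

definition restrict_tensor :: "nat \<Rightarrow> nat \<Rightarrow> (nat list \<Rightarrow> real) \<Rightarrow> nat list \<Rightarrow> real"
  where "restrict_tensor m p y = (\<lambda>ks. if ks \<in> sorted_tuples m p then y ks else 0)"

lemma linear_restrict_tensor: "linear (restrict_tensor m p)"
  by (rule linearI) (auto simp: restrict_tensor_def scaleR_fun_def fun_eq_iff)

text \<open>For \<open>m \<le> d\<close> the coordinates of the smaller tensor power are among those
  of the larger one, even if the vector has nonzero entries beyond \<open>m\<close>.\<close>

lemma tensorized_subspace_restrict:
  assumes "m \<le> d"
  shows "tensorized_subspace m p V = restrict_tensor m p ` tensorized_subspace d p V"
proof -
  have "restrict_tensor m p (tensor_power d p x) = tensor_power m p x" for x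
    using assms by (auto simp: restrict_tensor_def tensor_power_def sorted_tuples_def fun_eq_iff)
  then show ?thesis
    by (simp add: tensorized_subspace_def linear_span_image[OF linear_restrict_tensor, symmetric] image_image)
qed

text \<open>Injectivity is known only on the given subspace. Hence a competitor is first shown to
  lie inside it, one coordinate at a time, and only then to be equal to it.\<close>

lemma uniquely_identifiable_if_dim_eq:
  assumes "s + p \<le> m" and "m \<le> d"
    and dim: "dim (tensorized_subspace s p V) = dim (tensorized_subspace d p V)"
  shows "uniquely_identifiable (RD d p) (tensorized_patterns d p m) (tensorized_subspace d p V)"
proof -
  let ?S = "tensorized_subspace d p V"
  have "inj_on (restrict_tensor s p) (span ?S)"
    using assms by (intro inj_on_if_dim_image[OF linear_restrict_tensor tensorized_subspace_subset_RD])
      (simp_all add: tensorized_subspace_restrict[of s d])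
  then have inj: "inj_on (restrict_tensor s p) ?S"
    by (rule inj_on_subset) (rule span_superset)
  \<comment> \<open>The indicator vector of \<open>J\<close> is the pattern.\<close>
  have pattern: "\<exists>\<upsilon>\<in>tensorized_patterns d p m. \<forall>ks\<in>sorted_tuples d p. set ks \<subseteq> J \<longrightarrow> \<upsilon> ks = 1"
    if "J \<subseteq> {1..d}" "card J = m" for J
  proof -
    define \<omega> :: "nat \<Rightarrow> real" where "\<omega> i = (if i \<in> J then 1 else 0)" for i
    have "{i. \<omega> i = 1} = J" by (auto simp: \<omega>_def)
    then have "tensor_power d p \<omega> \<in> tensorized_patterns d p m"
      using that unfolding tensorized_patterns_def
      by (intro imageI) (auto simp: \<omega>_def coord_space_def)
    moreover have "tensor_power d p \<omega> ks = 1" if "ks \<in> sorted_tuples d p" "set ks \<subseteq> J" for ks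
    proof -
      have "prod_list (map \<omega> ks) = 1"
        using that(2) by (induction ks) (auto simp: \<omega>_def)
      then show ?thesis using that(1) by (simp add: tensor_power_def)
    qed
    ultimately show ?thesis by blast
  qed
  \<comment> \<open>Stated for an arbitrary pair of sets because it is applied in both
    directions.\<close>
  have transfer: "\<exists>z\<in>S'. restrict_tensor s p z = restrict_tensor s p y \<and>
      (\<forall>ks\<in>sorted_tuples d p. set ks \<subseteq> A \<longrightarrow> z ks = y ks)"
    if proj: "\<forall>\<upsilon>\<in>tensorized_patterns d p m. canonical_projection \<upsilon> S'' = canonical_projection \<upsilon> S'"
      and y: "y \<in> S''" and A: "A \<subseteq> {1..d}" "card A \<le> p" for S' S'' y A
  proof -
    have "card ({1..s} \<union> A) \<le> m"
      using card_Un_le[of "{1..s}" A] A assms(1) by simp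
    moreover have "{1..s} \<union> A \<subseteq> {1..d}" using A assms by auto
    ultimately obtain J where J: "{1..s} \<union> A \<subseteq> J" "J \<subseteq> {1..d}" "card J = m"
      using exists_subset_between[of "{1..s} \<union> A" m "{1..d}"] assms(2) by auto
    obtain \<upsilon> where \<upsilon>: "\<upsilon> \<in> tensorized_patterns d p m"
      "\<And>ks. ks \<in> sorted_tuples d p \<Longrightarrow> set ks \<subseteq> J \<Longrightarrow> \<upsilon> ks = 1"
      using pattern[OF J(2,3)] by metis
    have "restrict y {k. \<upsilon> k = 1} \<in> canonical_projection \<upsilon> S'"
      using bspec[OF proj \<upsilon>(1)] y by (auto simp: canonical_projection_def)
    then obtain z where z: "z \<in> S'" "restrict y {k. \<upsilon> k = 1} = restrict z {k. \<upsilon> k = 1}"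
      by (auto simp: canonical_projection_def)
    have eq: "z ks = y ks" if "ks \<in> sorted_tuples d p" "set ks \<subseteq> J" for ks
      using fun_cong[OF z(2), of ks] \<upsilon>(2)[OF that] by simp
    have "restrict_tensor s p z = restrict_tensor s p y"
    proof
      fix ks show "restrict_tensor s p z ks = restrict_tensor s p y ks"
      proof (cases "ks \<in> sorted_tuples s p")
        case True
        then have "ks \<in> sorted_tuples d p" "set ks \<subseteq> J"
          using J assms by (auto simp: sorted_tuples_def)
        then show ?thesis using eq by (simp add: restrict_tensor_def)
      qed (simp add: restrict_tensor_def)
    qed
    moreover have "\<forall>ks\<in>sorted_tuples d p. set ks \<subseteq> A \<longrightarrow> z ks = y ks"
      using eq J(1) by blast
    ultimately show ?thesis using z(1) by blast
  qed
  show ?thesis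
    unfolding uniquely_identifiable_def
  proof (intro allI impI)
    fix S' assume S': "subspace S' \<and> S' \<subseteq> RD d p \<and>
      (\<forall>\<upsilon>\<in>tensorized_patterns d p m. canonical_projection \<upsilon> S' = canonical_projection \<upsilon> ?S)"
    then have proj: "\<forall>\<upsilon>\<in>tensorized_patterns d p m. canonical_projection \<upsilon> S' = canonical_projection \<upsilon> ?S"
      and proj': "\<forall>\<upsilon>\<in>tensorized_patterns d p m. canonical_projection \<upsilon> ?S = canonical_projection \<upsilon> S'"
      by simp_all
    have sub: "S' \<subseteq> ?S"
    proof
      fix y assume y: "y \<in> S'"
      \<comment> \<open>With the empty set for \<open>A\<close>, the candidate \<open>z\<close> is
        fixed before any tuple \<open>ks\<close> is considered.\<close>
      obtain z where z: "z \<in> ?S" "restrict_tensor s p z = restrict_tensor s p y"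
        using transfer[OF proj y, of "{}"] by auto
      have "z = y"
      proof
        fix ks show "z ks = y ks"
        proof (cases "ks \<in> sorted_tuples d p")
          case True
          then have ks: "set ks \<subseteq> {1..d}" "card (set ks) \<le> p"
            using card_length[of ks] by (auto simp: sorted_tuples_def)
          obtain z' where z': "z' \<in> ?S" "restrict_tensor s p z' = restrict_tensor s p y" "z' ks = y ks"
            using transfer[OF proj y ks] True by blast
          \<comment> \<open>The element \<open>z'\<close> was chosen for \<open>ks\<close>, but it
            has the same restriction as \<open>z\<close>, so injectivity removes the dependence on
            \<open>ks\<close>.\<close>
          have "z' = z" using inj z z' by (metis inj_onD)
          then show ?thesis using z' by simp
        next
          case False
          have "z \<in> RD d p" "y \<in> RD d p"
            using z(1) y S' tensorized_subspace_subset_RD by auto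
          then show ?thesis using False by (simp add: coord_space_def)
        qed
      qed
      then show "y \<in> ?S" using z by simp
    qed
    moreover have "?S \<subseteq> S'"
    proof
      fix y assume y: "y \<in> ?S"
      obtain z where z: "z \<in> S'" "restrict_tensor s p z = restrict_tensor s p y"
        using transfer[OF proj' y, of "{}"] by auto
      \<comment> \<open>The inclusion just proved places \<open>z\<close> in the given subspace,
        where restriction is injective.\<close>
      have "z = y" using inj z y sub by (metis inj_onD subsetD)
      then show "y \<in> S'" using z by simp
    qed
    ultimately show "S' = ?S" by blast
  qed
qed

section \<open>Comparison of generic dimensions and conclusion\<close>

lemma Grassmannian_mono: "s \<le> d \<Longrightarrow> Grassmannian r s \<subseteq> Grassmannian r d"
  by (fastforce simp: Grassmannian_def coord_space_def)

lemma generic_dim_tensorized_subspace_eq: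
  assumes "r \<ge> 1" and "r \<le> s" and "s \<le> d" and eq: "generic_dim s K r p = generic_dim d K r p"
  shows "generic_union d K r (\<lambda>V. dim (tensorized_subspace s p V) = dim (tensorized_subspace d p V))"
proof -
  have rd: "r \<le> d" using assms by simp
  \<comment> \<open>\<open>Us\<close>, \<open>Ud\<close> and \<open>Ue\<close> attain
    \<open>N(s, s)\<close>, \<open>N(s, d)\<close> and \<open>N(d, d)\<close> respectively.\<close>
  obtain Us where Us: "Us \<in> topspace (Grassmannian_power s K r)"
    "\<forall>U\<in>topspace (Grassmannian_power s K r).
      dim (tensorized_subspace s p (\<Union>k\<in>{1..K}. U k)) \<le> dim (tensorized_subspace s p (\<Union>k\<in>{1..K}. Us k))"
    "generic_union s K r (\<lambda>V. dim (tensorized_subspace s p V) = dim (tensorized_subspace s p (\<Union>k\<in>{1..K}. Us k)))"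
    by (rule generic_dim_tensorized_subspace[OF assms(1,2), where K = K and m = s and p = p])
  obtain Ud where Ud: "Ud \<in> topspace (Grassmannian_power d K r)"
    "\<forall>U\<in>topspace (Grassmannian_power d K r).
      dim (tensorized_subspace s p (\<Union>k\<in>{1..K}. U k)) \<le> dim (tensorized_subspace s p (\<Union>k\<in>{1..K}. Ud k))"
    and gen_s: "generic_union d K r (\<lambda>V. dim (tensorized_subspace s p V) = dim (tensorized_subspace s p (\<Union>k\<in>{1..K}. Ud k)))"
    by (rule generic_dim_tensorized_subspace[OF assms(1) rd, where K = K and m = s and p = p])
  obtain Ue where "Ue \<in> topspace (Grassmannian_power d K r)"
    "\<forall>U\<in>topspace (Grassmannian_power d K r).
      dim (tensorized_subspace d p (\<Union>k\<in>{1..K}. U k)) \<le> dim (tensorized_subspace d p (\<Union>k\<in>{1..K}. Ue k))"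
    and gen_d: "generic_union d K r (\<lambda>V. dim (tensorized_subspace d p V) = dim (tensorized_subspace d p (\<Union>k\<in>{1..K}. Ue k)))"
    by (rule generic_dim_tensorized_subspace[OF assms(1) rd, where K = K and m = d and p = p])
  have "generic_dim s K r p = dim (tensorized_subspace s p (\<Union>k\<in>{1..K}. Us k))"
    by (rule generic_dim_eqI[OF Us(3) assms(2)])
  \<comment> \<open>Subspaces of \<open>Rn s\<close> are also subspaces of \<open>Rn d\<close>, so
    \<open>Us\<close> competes in the maximum attained by \<open>Ud\<close>.\<close>
  moreover have "Us \<in> topspace (Grassmannian_power d K r)"
    using Us(1) Grassmannian_mono[OF assms(3)] by (auto simp: PiE_iff)
  ultimately have "generic_dim s K r p \<le> dim (tensorized_subspace s p (\<Union>k\<in>{1..K}. Ud k))"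
    using Ud(2) by (metis (no_types, lifting))
  moreover have "generic_dim d K r p = dim (tensorized_subspace d p (\<Union>k\<in>{1..K}. Ue k))"
    by (rule generic_dim_eqI[OF gen_d rd])
  ultimately have ge: "dim (tensorized_subspace d p (\<Union>k\<in>{1..K}. Ue k)) \<le> dim (tensorized_subspace s p (\<Union>k\<in>{1..K}. Ud k))"
    using eq by simp
  \<comment> \<open>Restriction is linear and cannot raise the dimension. With \<open>ge\<close>
    this forces equality wherever both generic values are attained.\<close>
  have le: "dim (tensorized_subspace s p V) \<le> dim (tensorized_subspace d p V)" for V
  proof -
    obtain C where C: "tensorized_subspace d p V \<subseteq> span C" "finite C" "card C = dim (tensorized_subspace d p V)"
      by (rule finite_basis_exists[OF tensorized_subspace_subset_RD finite_sorted_tuples])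
    have "tensorized_subspace s p V \<subseteq> restrict_tensor s p ` span C"
      unfolding tensorized_subspace_restrict[OF assms(3)] using C(1) by (rule image_mono)
    also have "\<dots> = span (restrict_tensor s p ` C)"
      by (rule linear_span_image[OF linear_restrict_tensor, symmetric])
    finally have "dim (tensorized_subspace s p V) \<le> card (restrict_tensor s p ` C)"
      using C(2) by (intro real_vector.dim_le_card) simp_all
    also have "\<dots> \<le> card C" using C(2) by (rule card_image_le)
    finally show ?thesis using C(3) by simp
  qed
  show ?thesis
    using generic_union_conj[OF gen_s gen_d]
  proof (rule generic_union_mono)
    fix U
    assume "dim (tensorized_subspace s p (\<Union>k\<in>{1..K}. U k)) = dim (tensorized_subspace s p (\<Union>k\<in>{1..K}. Ud k)) \<and>
      dim (tensorized_subspace d p (\<Union>k\<in>{1..K}. U k)) = dim (tensorized_subspace d p (\<Union>k\<in>{1..K}. Ue k))"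
    then show "dim (tensorized_subspace s p (\<Union>k\<in>{1..K}. U k)) = dim (tensorized_subspace d p (\<Union>k\<in>{1..K}. U k))"
      using ge le[of "\<Union>k\<in>{1..K}. U k"] by linarith
  qed
qed

theorem corollary2:
  fixes d K r p :: nat
  assumes "d \<ge> 1" and "K \<ge> 1" and "r \<ge> 1" and "p \<ge> 1" and "r \<le> d"
  shows "generic_union d K r (\<lambda>V.
    \<forall>mstar. r < mstar \<and> mstar \<le> d \<and> generic_dim mstar K r p = generic_dim d K r p \<longrightarrow>
      (\<forall>m. mstar + p \<le> m \<and> m \<le> d \<longrightarrow>
        uniquely_identifiable (RD d p) (tensorized_patterns d p m) (tensorized_subspace d p V)))"
proof -
  \<comment> \<open>The admissible values of \<open>mstar\<close> are finite in number and do not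
    depend on the union, so one open dense set serves all of them.\<close>
  let ?I = "{s. r < s \<and> s \<le> d \<and> generic_dim s K r p = generic_dim d K r p}"
  have "generic_union d K r (\<lambda>V. \<forall>s\<in>?I. dim (tensorized_subspace s p V) = dim (tensorized_subspace d p V))"
  proof (rule generic_union_ball)
    have "?I \<subseteq> {..d}" by blast
    then show "finite ?I" by (rule finite_subset) simp
  next
    fix s assume "s \<in> ?I"
    then show "generic_union d K r (\<lambda>V. dim (tensorized_subspace s p V) = dim (tensorized_subspace d p V))"
      using assms(3) by (intro generic_dim_tensorized_subspace_eq) simp_all
  qed
  then show ?thesis
  proof (rule generic_union_mono)
    fix U
    assume "\<forall>s\<in>?I. dim (tensorized_subspace s p (\<Union>k\<in>{1..K}. U k)) = dim (tensorized_subspace d p (\<Union>k\<in>{1..K}. U k))"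
    then show "\<forall>mstar. r < mstar \<and> mstar \<le> d \<and> generic_dim mstar K r p = generic_dim d K r p \<longrightarrow>
      (\<forall>m. mstar + p \<le> m \<and> m \<le> d \<longrightarrow>
        uniquely_identifiable (RD d p) (tensorized_patterns d p m) (tensorized_subspace d p (\<Union>k\<in>{1..K}. U k)))"
      by (auto intro: uniquely_identifiable_if_dim_eq)
  qed
qed

end
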